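(* Let $\bar f_1,\dots,\bar f_n:\mathbb{R}^m\to\mathbb{R}$ be convex, with $\bar f_j$ being $\bar{\mathbf{M}}_j$-smooth, let $\bar f=\frac1n\sum_j\bar f_j$ be $\bar L$-smooth and $\bar\mu$-strongly convex, let $\bar\psi:\mathbb{R}^m\to\mathbb{R}\cup\{+\infty\}$ be convex, $\bar P=\bar f+\bar\psi$, and let $\bar x^*$ be the minimizer of $\bar P$. Let $\bar{\mathcal{L}}>0$ be such that the iterates of the L-Katyusha variant satisfy $\mathbb{E}[\|\bar g^k-\nabla\bar f(\bar x^k)\|^2]\le2\bar{\mathcal{L}}D_{\bar f}(\bar w^k,\bar x^k)$ for all $k$. Then the iteration complexity of the L-Katyusha variant, run on $\min_{\bar x\in\mathbb{R}^m}\bar P(\bar x)$ with parameters $$\bar\eta=\tfrac14\max\{\bar{\mathcal{L}},\bar L\}^{-1},\ \ \theta_2=\frac{\bar{\mathcal{L}}}{2\max\{\bar L,\bar{\mathcal{L}}\}},\ \ \theta_1=\min\left\{\tfrac12,\sqrt{\bar\eta\bar\mu\max\{\tfrac12,\tfrac{\theta_2}\rho\}}\right\},\ \ \bar\gamma=\frac1{\max\{2\bar\mu,4\theta_1/\bar\eta\}},\ \ \beta=1-\bar\gamma\bar\mu,$$ is $$\mathcal{O}\left(\left(\frac1\rho+\sqrt{\frac{\bar L}{\bar\mu}}+\sqrt{\frac{\bar{\mathcal{L}}}{\bar\mu\rho}}\right)\log\frac1\epsilon\right).$$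
   Context: Notation: $D_{\bar f}(x,y)=\bar f(x)-\bar f(y)-\langle\nabla\bar f(y),x-y\rangle$. $\bar f_j$ is $\bar{\mathbf{M}}_j$-smooth if $\bar f_j(x)\le\bar f_j(y)+\langle\nabla\bar f_j(y),x-y\rangle+\frac12\langle\bar{\mathbf{M}}_j(x-y),x-y\rangle$ for all $x,y$. $\mathrm{prox}_{\bar\eta\bar\psi}(x)=\arg\min_y\{\bar\eta\bar\psi(y)+\frac12\|y-x\|^2\}$, assumed well defined (e.g. $\bar\psi$ proper, closed, convex). L-Katyusha variant (parameters $0<\theta_1,\theta_2<1$, $\bar\eta,\beta,\bar\gamma>0$, $\rho\in(0,1)$, random set $\bar S\subseteq\{1,\dots,n\}$ with $\bar p_j=\mathbb{P}(j\in\bar S)>0$): start with $\bar w^0=\bar y^0=\bar z^0=\bar x^0$. For $k=0,1,\dots$: $\bar x^k=\theta_1\bar z^k+\theta_2\bar w^k+(1-\theta_1-\theta_2)\bar y^k$; sample a fresh independent copy of $\bar S$; $\bar g^k=\nabla\bar f(\bar w^k)+\frac1n\sum_{j\in\bar S}\frac1{\bar p_j}(\nabla\bar f_j(\bar x^k)-\nabla\bar f_j(\bar w^k))$; $\bar y^{k+1}=\mathrm{prox}_{\bar\eta\bar\psi}(\bar x^k-\bar\eta\bar g^k)$; $\bar z^{k+1}=\beta\bar z^k+(1-\beta)\bar x^k+\frac{\bar\gamma}{\bar\eta}(\bar y^{k+1}-\bar x^k)$; $\bar w^{k+1}=\bar y^k$ with probability $\rho$, $\bar w^{k+1}=\bar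 w^k$ with probability $1-\rho$ (independently). The expectation in the bound defining $\bar{\mathcal{L}}$ is over the sampling of $\bar S$ at iteration $k$. "Iteration complexity $\mathcal{O}(K\log\frac1\epsilon)$" means: there is a universal constant $c$ such that for every $\epsilon\in(0,1)$ and every $k\ge cK\log\frac1\epsilon$ one has $\mathbb{E}[\bar\Psi^k]\le\epsilon\bar\Psi^0$, where $$\bar\Psi^k=\|\bar z^k-\bar x^*\|^2+\frac{2\bar\gamma\beta}{\theta_1}[\bar P(\bar y^k)-\bar P(\bar x^* )]+\frac{(2\theta_2+\theta_1)\bar\gamma\beta}{\theta_1\rho}[\bar P(\bar w^k)-\bar P(\bar x^* )].$$ *)

theory Defs
  imports "HOL-Probability.Probability"
begin

definition gradient :: "('a::real_inner \<Rightarrow> real) \<Rightarrow> 'a \<Rightarrow> 'a" where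
  "gradient f x = (THE D. GDERIV f x :> D)"

definition bregman :: "('a::real_inner \<Rightarrow> real) \<Rightarrow> 'a \<Rightarrow> 'a \<Rightarrow> real" where
  "bregman f x y = f x - f y - gradient f y \<bullet> (x - y)"

definition matrix_smooth :: "real^'m^'m \<Rightarrow> (real^'m \<Rightarrow> real) \<Rightarrow> bool" where
  "matrix_smooth M f \<longleftrightarrow>
     (\<forall>x. f differentiable (at x)) \<and>
     (\<forall>x y. f x \<le> f y + gradient f y \<bullet> (x - y) + 1/2 * ((M *v (x - y)) \<bullet> (x - y)))"

definition smooth :: "real \<Rightarrow> ('a::real_inner \<Rightarrow> real) \<Rightarrow> bool" where
  "smooth L f \<longleftrightarrow>
     (\<forall>x. f differentiable (at x)) \<and>
     (\<forall>x y. f x \<le> f y + gradient f y \<bullet> (x - y) + L/2 * (norm (x - y))\<^sup>2)"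

text \<open>Only applied to differentiable functions, hence the gradient form of strong convexity.\<close>
definition strongly_convex :: "real \<Rightarrow> ('a::real_inner \<Rightarrow> real) \<Rightarrow> bool" where
  "strongly_convex \<mu> f \<longleftrightarrow>
     (\<forall>x y. f x \<ge> f y + gradient f y \<bullet> (x - y) + \<mu>/2 * (norm (x - y))\<^sup>2)"

text \<open>Since \<^term>\<open>(0::ereal) * \<infinity> = 0\<close>, the endpoints \<open>t = 0\<close> and \<open>t = 1\<close> impose nothing.\<close>
definition ereal_convex :: "('a::real_vector \<Rightarrow> ereal) \<Rightarrow> bool" where
  "ereal_convex h \<longleftrightarrow>
     (\<forall>x y. \<forall>t\<in>{0..1}. h ((1 - t) *\<^sub>R x + t *\<^sub>R y) \<le> ereal (1 - t) * h x + ereal t * h y)"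

definition average :: "nat \<Rightarrow> (nat \<Rightarrow> 'a \<Rightarrow> real) \<Rightarrow> 'a \<Rightarrow> real" where
  "average n f x = (1 / real n) * (\<Sum>j=1..n. f j x)"

definition prox_objective :: "real \<Rightarrow> ('a::real_normed_vector \<Rightarrow> ereal) \<Rightarrow> 'a \<Rightarrow> 'a \<Rightarrow> ereal" where
  "prox_objective \<eta> \<psi> x y = ereal \<eta> * \<psi> y + ereal (1/2 * (norm (y - x))\<^sup>2)"

definition prox_well_defined :: "real \<Rightarrow> ('a::real_normed_vector \<Rightarrow> ereal) \<Rightarrow> bool" where
  "prox_well_defined \<eta> \<psi> \<longleftrightarrow> (\<forall>x. \<exists>!y. is_arg_min (prox_objective \<eta> \<psi> x) (\<lambda>_. True) y)"

definition prox :: "real \<Rightarrow> ('a::real_normed_vector \<Rightarrow> ereal) \<Rightarrow> 'a \<Rightarrow> 'a" where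
  "prox \<eta> \<psi> x = arg_min (prox_objective \<eta> \<psi> x) (\<lambda>_. True)"

definition inclusion_prob :: "nat set pmf \<Rightarrow> nat \<Rightarrow> real" where
  "inclusion_prob S j = measure_pmf.prob S {A. j \<in> A}"

definition grad_estimator ::
    "nat \<Rightarrow> (nat \<Rightarrow> 'a::real_inner \<Rightarrow> real) \<Rightarrow> nat set pmf \<Rightarrow> 'a \<Rightarrow> 'a \<Rightarrow> nat set \<Rightarrow> 'a" where
  "grad_estimator n f S x w A =
     gradient (average n f) w +
     (1 / real n) *\<^sub>R
       (\<Sum>j\<in>A. (1 / inclusion_prob S j) *\<^sub>R (gradient (f j) x - gradient (f j) w))"

definition katyusha_x :: "real \<Rightarrow> real \<Rightarrow> 'a \<times> 'a \<times> 'a \<Rightarrow> 'a::real_vector" where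
  "katyusha_x \<theta>1 \<theta>2 = (\<lambda>(y, z, w). \<theta>1 *\<^sub>R z + \<theta>2 *\<^sub>R w + (1 - \<theta>1 - \<theta>2) *\<^sub>R y)"

text \<open>The law of the iterates \<open>(y\<^sup>k, z\<^sup>k, w\<^sup>k)\<close>, which form a Markov chain; \<open>x\<^sup>k\<close> is a function of
  them. In each iteration the set \<open>A\<close> and the coin \<open>b\<close> are drawn independently of each other
  and of the past. All these distributions have finite support.\<close>
primrec katyusha ::
    "nat \<Rightarrow> (nat \<Rightarrow> 'a::real_inner \<Rightarrow> real) \<Rightarrow> ('a \<Rightarrow> ereal) \<Rightarrow> nat set pmf \<Rightarrow>
     real \<Rightarrow> real \<Rightarrow> real \<Rightarrow> real \<Rightarrow> real \<Rightarrow> real \<Rightarrow> 'a \<Rightarrow> nat \<Rightarrow> ('a \<times> 'a \<times> 'a) pmf" where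
  "katyusha n f \<psi> S \<rho> \<eta> \<theta>1 \<theta>2 \<gamma> \<beta> x0 0 = return_pmf (x0, x0, x0)"
| "katyusha n f \<psi> S \<rho> \<eta> \<theta>1 \<theta>2 \<gamma> \<beta> x0 (Suc k) =
     bind_pmf (katyusha n f \<psi> S \<rho> \<eta> \<theta>1 \<theta>2 \<gamma> \<beta> x0 k) (\<lambda>(y, z, w).
     bind_pmf S (\<lambda>A.
     bind_pmf (bernoulli_pmf \<rho>) (\<lambda>b.
       let x = katyusha_x \<theta>1 \<theta>2 (y, z, w);
           g = grad_estimator n f S x w A;
           y' = prox \<eta> \<psi> (x - \<eta> *\<^sub>R g);
           z' = \<beta> *\<^sub>R z + (1 - \<beta>) *\<^sub>R x + (\<gamma> / \<eta>) *\<^sub>R (y' - x);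
           w' = (if b then y else w)
       in return_pmf (y', z', w'))))"

definition composite :: "('a \<Rightarrow> real) \<Rightarrow> ('a \<Rightarrow> ereal) \<Rightarrow> 'a \<Rightarrow> ereal" where
  "composite f \<psi> x = ereal (f x) + \<psi> x"

definition lyapunov ::
    "('a::real_normed_vector \<Rightarrow> ereal) \<Rightarrow> 'a \<Rightarrow> real \<Rightarrow> real \<Rightarrow> real \<Rightarrow> real \<Rightarrow> real \<Rightarrow>
     'a \<times> 'a \<times> 'a \<Rightarrow> ereal" where
  "lyapunov P xs \<rho> \<theta>1 \<theta>2 \<gamma> \<beta> = (\<lambda>(y, z, w).
     ereal ((norm (z - xs))\<^sup>2)
     + ereal (2 * \<gamma> * \<beta> / \<theta>1) * (P y - P xs)
     + ereal ((2 * \<theta>2 + \<theta>1) * \<gamma> * \<beta> / (\<theta>1 * \<rho>)) * (P w - P xs))"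

text \<open>The expectation of \<open>\<Psi>\<^sup>k\<close> is taken in \<open>[0, \<infinity>]\<close>, because \<open>P\<close> may be infinite at the starting
  point. If \<open>xs\<close> minimizes \<open>P\<close>, then \<^const>\<open>lyapunov\<close> is nonnegative, so that
  \<^const>\<open>e2ennreal\<close>, which sends negative values to \<open>0\<close>, loses nothing.\<close>
definition expected_lyapunov ::
    "nat \<Rightarrow> (nat \<Rightarrow> 'a::real_inner \<Rightarrow> real) \<Rightarrow> ('a \<Rightarrow> ereal) \<Rightarrow> nat set pmf \<Rightarrow>
     real \<Rightarrow> real \<Rightarrow> real \<Rightarrow> real \<Rightarrow> real \<Rightarrow> real \<Rightarrow> 'a \<Rightarrow> 'a \<Rightarrow> nat \<Rightarrow> ennreal" where
  "expected_lyapunov n f \<psi> S \<rho> \<eta> \<theta>1 \<theta>2 \<gamma> \<beta> x0 xs k =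
     (\<integral>\<^sup>+ s. e2ennreal (lyapunov (composite (average n f) \<psi>) xs \<rho> \<theta>1 \<theta>2 \<gamma> \<beta> s)
        \<partial>measure_pmf (katyusha n f \<psi> S \<rho> \<eta> \<theta>1 \<theta>2 \<gamma> \<beta> x0 k))"

text \<open>The expectation is over the sampling of \<open>S\<close> in iteration \<open>k\<close> only, conditionally on the
  past, so the bound is required at every state that iteration \<open>k\<close> attains with positive
  probability.\<close>
definition variance_bound ::
    "nat \<Rightarrow> (nat \<Rightarrow> 'a::real_inner \<Rightarrow> real) \<Rightarrow> ('a \<Rightarrow> ereal) \<Rightarrow> nat set pmf \<Rightarrow>
     real \<Rightarrow> real \<Rightarrow> real \<Rightarrow> real \<Rightarrow> real \<Rightarrow> real \<Rightarrow> 'a \<Rightarrow> real \<Rightarrow> bool" where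
  "variance_bound n f \<psi> S \<rho> \<eta> \<theta>1 \<theta>2 \<gamma> \<beta> x0 LL \<longleftrightarrow>
     (\<forall>k. \<forall>(y, z, w) \<in> set_pmf (katyusha n f \<psi> S \<rho> \<eta> \<theta>1 \<theta>2 \<gamma> \<beta> x0 k).
        let x = katyusha_x \<theta>1 \<theta>2 (y, z, w) in
        measure_pmf.expectation S
          (\<lambda>A. (norm (grad_estimator n f S x w A - gradient (average n f) x))\<^sup>2)
        \<le> 2 * LL * bregman (average n f) w x)"

end

theory Submission
  imports Defs
begin

text \<open>
  The Lyapunov function contracts in expectation by a fixed factor \<open>1 - \<delta>\<close> per iteration, where
  \<open>\<delta> = min {\<gamma>\<mu>, \<theta>1/2, \<rho>\<theta>1/(2\<theta>2 + \<theta>1)}\<close>, and the parameters are tuned such that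
  \<open>1/\<delta> \<le> 6 (1/\<rho> + sqrt (L/\<mu>) + sqrt (LL/(\<mu>\<rho>)))\<close>.  Since \<open>(1 - \<delta>)\<^sup>k \<le> exp (- \<delta>k)\<close>, the constant
  \<open>6\<close> suffices.

  The contraction is a linear coupling argument.  The proximal step is compared with three points,
  the minimizer \<open>xs\<close>, the reference point \<open>w\<close> and the previous iterate \<open>y\<close>, weighted in the way
  in which \<open>x\<close> is composed of \<open>z\<close>, \<open>w\<close> and \<open>y\<close>; the inner product with the step that
  results cancels the cross term in the expansion of the squared distance from the new \<open>z\<close> to
  \<open>xs\<close> (lemma \<open>coupling_step\<close>).  The comparison with \<open>w\<close> provides a negative multiple of the
  Bregman distance from \<open>w\<close> to \<open>x\<close>, and this pays for the variance of the gradient estimator once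
  the expectation over the sampled set is taken (lemma \<open>step_expectation\<close>).  The weight of
  \<open>w\<close> in the Lyapunov function balances the gap that flows from \<open>w\<close> into the new \<open>y\<close> against
  the occasional replacement of \<open>w\<close> by \<open>y\<close> (lemma \<open>potential_drift\<close>).
  The bound on \<open>1/\<delta>\<close> is lemma \<open>contraction_rate\<close>.

  The function \<open>\<psi>\<close> may take the value infinity.  Proximal steps always land in its domain, so a chain
  started in the domain stays there and real arithmetic applies; for a start outside the domain
  the initial value of the Lyapunov function is infinite.
\<close>

section \<open>Gradients and the gradient estimator\<close>

lemma GDERIV_unique:
  fixes f :: "'a::real_inner \<Rightarrow> real"
  assumes "GDERIV f x :> d" "GDERIV f x :> d'"
  shows "d = d'"
proof -
  have "(\<lambda>h. h \<bullet> d) = (\<lambda>h. h \<bullet> d')"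
    using assms unfolding gderiv_def by (rule has_derivative_unique)
  then have "(d - d') \<bullet> d = (d - d') \<bullet> d'" by metis
  then show ?thesis by (metis inner_diff_right inner_eq_zero_iff right_minus_eq)
qed

lemma gradient_eqI: "GDERIV f x :> d \<Longrightarrow> gradient f x = d"
  unfolding gradient_def using GDERIV_unique by blast

lemma GDERIV_gradient:
  fixes f :: "'a::euclidean_space \<Rightarrow> real"
  assumes "f differentiable (at x)"
  shows "GDERIV f x :> gradient f x"
proof -
  obtain f' where f': "(f has_derivative f') (at x)"
    using assms unfolding differentiable_def by blast
  then have lin: "linear f'" by (rule has_derivative_linear)
  have "f' h = h \<bullet> (\<Sum>b\<in>Basis. f' b *\<^sub>R b)" for h
  proof -
    have "f' h = f' (\<Sum>b\<in>Basis. (h \<bullet> b) *\<^sub>R b)" by (simp add: euclidean_representation)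
    also have "\<dots> = (\<Sum>b\<in>Basis. (h \<bullet> b) * f' b)"
      using lin by (simp add: linear_sum linear_scale)
    finally show ?thesis by (simp add: inner_sum_right mult.commute)
  qed
  then have "f' = (\<lambda>h. h \<bullet> (\<Sum>b\<in>Basis. f' b *\<^sub>R b))" by blast
  then have "GDERIV f x :> (\<Sum>b\<in>Basis. f' b *\<^sub>R b)"
    using f' unfolding gderiv_def by metis
  then show ?thesis using gradient_eqI by metis
qed

lemma gradient_average:
  fixes f :: "nat \<Rightarrow> 'a::euclidean_space \<Rightarrow> real"
  assumes "\<And>j. j \<in> {1..n} \<Longrightarrow> f j differentiable (at x)"
  shows "gradient (average n f) x = (1 / real n) *\<^sub>R (\<Sum>j=1..n. gradient (f j) x)"
proof (rule gradient_eqI)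
  have "((\<lambda>x. (1 / real n) * (\<Sum>j=1..n. f j x)) has_derivative
      (\<lambda>h. (1 / real n) * (\<Sum>j=1..n. h \<bullet> gradient (f j) x))) (at x)"
    by (intro has_derivative_mult_right has_derivative_sum)
      (use assms GDERIV_gradient in \<open>auto simp: gderiv_def\<close>)
  then show "GDERIV (average n f) x :> (1 / real n) *\<^sub>R (\<Sum>j=1..n. gradient (f j) x)"
    unfolding gderiv_def average_def[abs_def] by (simp add: inner_sum_right)
qed

text \<open>
  Horvitz--Thompson weighting: index \<^term>\<open>j\<close> is present with probability
  \<^term>\<open>inclusion_prob S j\<close>, which cancels its weight, so that linearity of the
  expectation settles the claim for arbitrarily dependent inclusions.
\<close>
lemma expectation_inverse_probability_sum:
  fixes a :: "nat \<Rightarrow> real"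
  assumes S: "set_pmf S \<subseteq> Pow {1..n}" and p: "\<And>j. j \<in> {1..n} \<Longrightarrow> inclusion_prob S j > 0"
  shows "measure_pmf.expectation S (\<lambda>A. \<Sum>j\<in>A. a j / inclusion_prob S j) = (\<Sum>j=1..n. a j)"
proof -
  have "measure_pmf.expectation S (\<lambda>A. \<Sum>j\<in>A. a j / inclusion_prob S j)
      = measure_pmf.expectation S
          (\<lambda>A. \<Sum>j=1..n. a j / inclusion_prob S j * indicator {A. j \<in> A} A)"
  proof (rule integral_cong_AE)
    show "AE A in measure_pmf S. (\<Sum>j\<in>A. a j / inclusion_prob S j)
        = (\<Sum>j=1..n. a j / inclusion_prob S j * indicator {A. j \<in> A} A)"
    proof (rule AE_pmfI)
      fix A assume "A \<in> set_pmf S"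
      then have "A \<subseteq> {1..n}" using S by blast
      then show "(\<Sum>j\<in>A. a j / inclusion_prob S j)
        = (\<Sum>j=1..n. a j / inclusion_prob S j * indicator {A. j \<in> A} A)"
        by (intro sum.mono_neutral_cong_left) (auto simp: indicator_def)
    qed
  qed auto
  also have "\<dots> = (\<Sum>j=1..n. a j / inclusion_prob S j * inclusion_prob S j)"
    using finite_subset[OF S]
    by (subst Bochner_Integration.integral_sum)
      (auto intro: integrable_measure_pmf_finite simp: inclusion_prob_def)
  also have "\<dots> = (\<Sum>j=1..n. a j)"
    using p by (intro sum.cong) (auto simp: less_le)
  finally show ?thesis .
qed

text \<open>
  Tested against a fixed vector \<^term>\<open>v\<close>, which is the only form in which the error of the
  estimator enters the analysis linearly, and which reduces the claim to real expectations.
\<close>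
lemma grad_estimator_unbiased:
  fixes f :: "nat \<Rightarrow> 'a::euclidean_space \<Rightarrow> real"
  assumes diff: "\<And>j x. j \<in> {1..n} \<Longrightarrow> f j differentiable (at x)"
    and S: "set_pmf S \<subseteq> Pow {1..n}"
    and p: "\<And>j. j \<in> {1..n} \<Longrightarrow> inclusion_prob S j > 0"
  shows "measure_pmf.expectation S
           (\<lambda>A. (grad_estimator n f S x w A - gradient (average n f) x) \<bullet> v) = 0"
proof -
  define d where "d j = (gradient (f j) x - gradient (f j) w) \<bullet> v" for j
  have fin: "finite (set_pmf S)" using finite_subset[OF S] by simp
  have avg: "gradient (average n f) u = (1 / real n) *\<^sub>R (\<Sum>j=1..n. gradient (f j) u)" for u
    by (rule gradient_average) (rule diff)
  have grad: "gradient (average n f) x \<bullet> v - gradient (average n f) w \<bullet> v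
      = (1 / real n) * (\<Sum>j=1..n. d j)"
    unfolding avg by (simp add: d_def inner_sum_left inner_diff_left sum_subtractf diff_divide_distrib)
  have "(grad_estimator n f S x w A - gradient (average n f) x) \<bullet> v
      = (1 / real n) * (\<Sum>j\<in>A. d j / inclusion_prob S j)
          - (gradient (average n f) x \<bullet> v - gradient (average n f) w \<bullet> v)" for A
    by (simp add: grad_estimator_def d_def inner_add_left inner_diff_left inner_sum_left
        diff_divide_distrib add_diff_eq diff_diff_eq2 add.commute)
  then have "measure_pmf.expectation S
      (\<lambda>A. (grad_estimator n f S x w A - gradient (average n f) x) \<bullet> v)
      = measure_pmf.expectation S (\<lambda>A. (1 / real n) * (\<Sum>j\<in>A. d j / inclusion_prob S j)
          - (gradient (average n f) x \<bullet> v - gradient (average n f) w \<bullet> v))"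
    by (intro Bochner_Integration.integral_cong) auto
  also have "\<dots>
      = (1 / real n) * measure_pmf.expectation S (\<lambda>A. \<Sum>j\<in>A. d j / inclusion_prob S j)
        - (gradient (average n f) x \<bullet> v - gradient (average n f) w \<bullet> v)"
    by (subst Bochner_Integration.integral_diff)
      (auto intro: integrable_measure_pmf_finite[OF fin])
  also have "\<dots> = 0"
    using expectation_inverse_probability_sum[OF S p, of d] grad by simp
  finally show ?thesis .
qed

section \<open>The proximal step\<close>

lemma prox_arg_min:
  assumes "prox_well_defined \<eta> \<psi>" "0 < \<eta>" "\<And>y. \<psi> y \<noteq> -\<infinity>" "\<psi> u \<noteq> \<infinity>"
  shows "is_arg_min (prox_objective \<eta> \<psi> v) (\<lambda>_. True) (prox \<eta> \<psi> v)"
    and "\<psi> (prox \<eta> \<psi> v) \<noteq> \<infinity>"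
proof -
  show min: "is_arg_min (prox_objective \<eta> \<psi> v) (\<lambda>_. True) (prox \<eta> \<psi> v)"
    using assms(1) unfolding prox_well_defined_def prox_def arg_min_def by (metis someI)
  then have "prox_objective \<eta> \<psi> v (prox \<eta> \<psi> v) \<le> prox_objective \<eta> \<psi> v u"
    by (auto simp: is_arg_min_def not_less)
  then show "\<psi> (prox \<eta> \<psi> v) \<noteq> \<infinity>"
    using assms by (cases "\<psi> u") (auto simp: prox_objective_def)
qed

text \<open>The first-order optimality condition: divide by \<^term>\<open>t\<close> and let it tend to zero.\<close>
lemma linear_bound_from_quadratic:
  fixes a b :: real
  assumes "\<And>t. 0 < t \<Longrightarrow> t < 1 \<Longrightarrow> 0 \<le> t * a + t\<^sup>2 * b"
  shows "0 \<le> a"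
proof (rule tendsto_lowerbound)
  show "((\<lambda>t. a + t * b) \<longlongrightarrow> a) (at_right 0)"
    by (rule tendsto_eq_intros refl | simp)+
  have "0 \<le> a + t * b" if "0 < t" "t < 1" for t
  proof -
    have "0 \<le> t * (a + t * b)"
      using assms[OF that] by (simp add: algebra_simps power2_eq_square)
    then show ?thesis using that by (simp add: zero_le_mult_iff)
  qed
  then show "\<forall>\<^sub>F t in at_right 0. 0 \<le> a + t * b"
    unfolding eventually_at_right_field by (intro exI[of _ 1]) auto
qed simp

text \<open>
  The inequality says that \<open>(v - q) / \<eta>\<close> is a subgradient of \<^term>\<open>\<psi>\<close> at \<open>q\<close>.  It follows by
  comparing the minimizer \<open>q\<close> of the proximal objective with a point at distance proportional to
  \<open>t\<close> on the segment from \<open>q\<close> to \<^term>\<open>u\<close>: the objective changes by a linear term in \<open>t\<close>,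
  which must be nonnegative, and a quadratic one.
\<close>
lemma prox_inequality:
  fixes \<psi> :: "'a::real_inner \<Rightarrow> ereal" and u v :: 'a
  assumes wd: "prox_well_defined \<eta> \<psi>" and \<eta>: "0 < \<eta>" and proper: "\<And>y. \<psi> y \<noteq> -\<infinity>"
    and conv: "ereal_convex \<psi>" and u: "\<psi> u \<noteq> \<infinity>"
  defines "q \<equiv> prox \<eta> \<psi> v"
  shows "\<eta> * real_of_ereal (\<psi> q) + (v - q) \<bullet> (u - q) \<le> \<eta> * real_of_ereal (\<psi> u)"
proof -
  define h where "h y = real_of_ereal (\<psi> y)" for y
  have q: "\<psi> q \<noteq> \<infinity>" unfolding q_def using prox_arg_min(2)[OF wd \<eta> proper u] .
  have \<psi>q: "\<psi> q = ereal (h q)" and \<psi>u: "\<psi> u = ereal (h u)"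
    unfolding h_def using q u proper[of q] proper[of u] by (auto simp: ereal_real)
  have "0 \<le> t * (\<eta> * (h u - h q) - (v - q) \<bullet> (u - q)) + t\<^sup>2 * ((norm (u - q))\<^sup>2 / 2)"
    if t: "0 < t" "t < 1" for t
  proof -
    define r where "r = (1 - t) *\<^sub>R q + t *\<^sub>R u"
    have "\<psi> r \<le> ereal (1 - t) * \<psi> q + ereal t * \<psi> u"
      using conv t unfolding ereal_convex_def r_def by auto
    then have r: "\<psi> r \<le> ereal ((1 - t) * h q + t * h u)" by (simp add: \<psi>q \<psi>u)
    then have \<psi>r: "\<psi> r = ereal (h r)" unfolding h_def using proper[of r] by (cases "\<psi> r") auto
    have hr: "h r \<le> (1 - t) * h q + t * h u" using r by (simp add: \<psi>r)
    have "prox_objective \<eta> \<psi> v q \<le> prox_objective \<eta> \<psi> v r"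
      using prox_arg_min(1)[OF wd \<eta> proper u, of v] by (auto simp: is_arg_min_def q_def not_less)
    then have "\<eta> * h q + 1/2 * (norm (q - v))\<^sup>2 \<le> \<eta> * h r + 1/2 * (norm (r - v))\<^sup>2"
      by (simp add: prox_objective_def \<psi>q \<psi>r)
    also have "\<eta> * h r \<le> \<eta> * ((1 - t) * h q + t * h u)" using hr \<eta> by simp
    finally have 1: "\<eta> * h q + 1/2 * (norm (q - v))\<^sup>2
        \<le> \<eta> * ((1 - t) * h q + t * h u) + 1/2 * (norm (r - v))\<^sup>2" by simp
    have "r - v = (q - v) + t *\<^sub>R (u - q)" by (simp add: r_def algebra_simps)
    then have "(norm (r - v))\<^sup>2
        = (norm (q - v))\<^sup>2 - 2 * t * ((v - q) \<bullet> (u - q)) + t\<^sup>2 * (norm (u - q))\<^sup>2"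
      unfolding power2_norm_eq_inner
      by (simp only: inner_add_left inner_add_right inner_scaleR_left inner_scaleR_right
          inner_diff_left inner_diff_right)
         (simp add: algebra_simps power2_eq_square inner_commute)
    with 1 show ?thesis by (simp add: algebra_simps)
  qed
  from linear_bound_from_quadratic[OF this] show ?thesis
    by (simp add: h_def algebra_simps)
qed


section \<open>One iteration\<close>

lemma norm_convex_combination_sq:
  fixes a b :: "'a::real_inner"
  assumes "0 \<le> t" "t \<le> 1"
  shows "(norm (t *\<^sub>R a + (1 - t) *\<^sub>R b))\<^sup>2 \<le> t * (norm a)\<^sup>2 + (1 - t) * (norm b)\<^sup>2"
proof -
  have "t * (norm a)\<^sup>2 + (1 - t) * (norm b)\<^sup>2 - (norm (t *\<^sub>R a + (1 - t) *\<^sub>R b))\<^sup>2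
      = t * (1 - t) * (norm (a - b))\<^sup>2"
    unfolding power2_norm_eq_inner
    by (simp only: inner_add_left inner_add_right inner_scaleR_left inner_scaleR_right
          inner_diff_left inner_diff_right inner_commute[of b a]) algebra
  moreover have "0 \<le> t * (1 - t) * (norm (a - b))\<^sup>2" using assms by simp
  ultimately show ?thesis by linarith
qed

text \<open>
  Young's inequality with the weights that the step size budget of the next lemma leaves over:
  a proximal step gains \<open>1/\<eta>\<close>, smoothness costs \<open>1/(8\<eta>)\<close>, and the analysis of the
  mirror sequence will need another \<open>1/(2\<eta>)\<close>, so \<open>3/(8\<eta>)\<close> may be spent here.
\<close>
lemma inner_young:
  fixes a b :: "'a::real_inner"
  assumes "0 < \<eta>"
  shows "- (a \<bullet> b) \<le> 2 * \<eta> / 3 * (norm a)\<^sup>2 + 3 / (8 * \<eta>) * (norm b)\<^sup>2"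
proof -
  have "0 \<le> 3 / (8 * \<eta>) * ((b + (4 * \<eta> / 3) *\<^sub>R a) \<bullet> (b + (4 * \<eta> / 3) *\<^sub>R a))"
    using assms by simp
  also have "\<dots> = 2 * \<eta> / 3 * (norm a)\<^sup>2 + 3 / (8 * \<eta>) * (norm b)\<^sup>2 + a \<bullet> b"
    using assms unfolding power2_norm_eq_inner
    by (simp add: inner_add_left inner_add_right inner_commute field_simps)
  finally show ?thesis by linarith
qed

text \<open>
  The decrease achieved by one proximal step along an inexact gradient \<^term>\<open>g\<close> in place of the true
  gradient \<^term>\<open>s\<close>, relative to an arbitrary comparison point \<^term>\<open>u\<close>.  The two terms that are
  linear in \<^term>\<open>u - x\<close> are kept exact, since they will be averaged over several points
  \<^term>\<open>u\<close>; the product of the gradient error with the step is split by Young's inequality.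
\<close>
lemma prox_gradient_descent:
  fixes x y' u g s :: "'a::real_inner" and F h :: "'a \<Rightarrow> real"
  assumes \<eta>: "0 < \<eta>"
    and prox: "\<eta> * h y' + (x - \<eta> *\<^sub>R g - y') \<bullet> (u - y') \<le> \<eta> * h u"
    and descent: "F y' \<le> F x + s \<bullet> (y' - x) + 1 / (8 * \<eta>) * (norm (y' - x))\<^sup>2"
  shows "F y' + h y' \<le> F x + h u + s \<bullet> (u - x) + ((y' - x) /\<^sub>R \<eta> + (g - s)) \<bullet> (u - x)
      + 2 * \<eta> / 3 * (norm (g - s))\<^sup>2 - 1 / (2 * \<eta>) * (norm (y' - x))\<^sup>2"
proof -
  define d where "d = y' - x"
  define v where "v = u - x"
  define e where "e = g - s"
  have y': "u - y' = v - d" "x - \<eta> *\<^sub>R g - y' = - (d + \<eta> *\<^sub>R (e + s))"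
    by (simp_all add: d_def v_def e_def)
  have "\<eta> * h y' \<le> \<eta> * h u + (d + \<eta> *\<^sub>R (e + s)) \<bullet> (v - d)"
    using prox unfolding y' inner_minus_left by linarith
  also have "\<dots> = \<eta> * (h u + (d /\<^sub>R \<eta> + (e + s)) \<bullet> (v - d))"
    using \<eta> by (simp add: inner_add_left distrib_left)
  finally have "h y' \<le> h u + (d /\<^sub>R \<eta> + (e + s)) \<bullet> (v - d)" using \<eta> by simp
  also have "\<dots> = h u + (d /\<^sub>R \<eta> + e) \<bullet> v + s \<bullet> v - 1 / \<eta> * (norm d)\<^sup>2 - e \<bullet> d - s \<bullet> d"
    unfolding power2_norm_eq_inner
    by (simp add: inner_add_left inner_diff_right algebra_simps divide_inverse)
  finally have "F y' + h y' \<le> F x + h u + s \<bullet> v + (d /\<^sub>R \<eta> + e) \<bullet> v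
      + (- (e \<bullet> d)) + 1 / (8 * \<eta>) * (norm d)\<^sup>2 - 1 / \<eta> * (norm d)\<^sup>2"
    using descent unfolding d_def[symmetric] by simp
  with inner_young[OF \<eta>, of e d]
  have "F y' + h y' \<le> F x + h u + s \<bullet> v + (d /\<^sub>R \<eta> + e) \<bullet> v + 2 * \<eta> / 3 * (norm e)\<^sup>2
      + (3 / (8 * \<eta>) * (norm d)\<^sup>2 + 1 / (8 * \<eta>) * (norm d)\<^sup>2 - 1 / \<eta> * (norm d)\<^sup>2)"
    by linarith
  also have "3 / (8 * \<eta>) * (norm d)\<^sup>2 + 1 / (8 * \<eta>) * (norm d)\<^sup>2 - 1 / \<eta> * (norm d)\<^sup>2
      = - (1 / (2 * \<eta>) * (norm d)\<^sup>2)"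
    using \<eta> by (simp add: field_simps)
  finally show ?thesis unfolding d_def v_def e_def by simp
qed

text \<open>
  The inequality that drives the whole analysis; it holds for every realization of the gradient
  estimate \<^term>\<open>g\<close>.  The preceding lemma is used at the three points
  \<^term>\<open>xs\<close>, \<^term>\<open>w\<close> and \<^term>\<open>y\<close> with weights \<open>1\<close>, \<open>\<beta>\<theta>2/\<theta>1\<close> and \<open>\<beta>(1 - \<theta>1 - \<theta>2)/\<theta>1\<close>.
  Since \<^term>\<open>x\<close> is a convex combination of \<^term>\<open>z\<close>, \<^term>\<open>w\<close> and
  \<^term>\<open>y\<close>, the weighted sum of the differences to \<^term>\<open>x\<close> collapses to
  \<open>xs - v\<close>.  The resulting inner product of the step with \<open>xs - v\<close> is exactly the cross term in
  the expansion of \<open>z' - xs\<close>, with opposite sign.  The term \<open>(1 - \<beta>) |x - xs|\<^sup>2\<close> that remains from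
  that expansion is paid by strong convexity, because \<^term>\<open>1 - \<beta> = \<gamma> * \<mu>\<close>.
  Apart from the gaps at \<^term>\<open>w\<close> and \<^term>\<open>y\<close>, what is left over is the squared
  error of \<^term>\<open>g\<close>, offset by the Bregman distance from \<^term>\<open>w\<close> to \<^term>\<open>x\<close>, and a term linear in the error.
\<close>
lemma coupling_step:
  fixes x y z w xs g s y' :: "'a::real_inner" and F h :: "'a \<Rightarrow> real"
  assumes par: "0 < \<mu>" "0 < \<eta>" "0 < \<theta>1" "\<theta>1 \<le> 1/2" "0 \<le> \<theta>2" "\<theta>1 + \<theta>2 \<le> 1"
      "0 < \<gamma>" "\<gamma> * \<mu> \<le> 1/2" "4 * \<theta>1 * \<gamma> \<le> \<eta>" "\<beta> = 1 - \<gamma> * \<mu>"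
    and x: "x = \<theta>1 *\<^sub>R z + \<theta>2 *\<^sub>R w + (1 - \<theta>1 - \<theta>2) *\<^sub>R y"
    and prox: "\<And>u. u \<in> {xs, w, y} \<Longrightarrow>
      \<eta> * h y' + (x - \<eta> *\<^sub>R g - y') \<bullet> (u - y') \<le> \<eta> * h u"
    and descent: "F y' \<le> F x + s \<bullet> (y' - x) + 1 / (8 * \<eta>) * (norm (y' - x))\<^sup>2"
    and strong: "F x + s \<bullet> (xs - x) + \<mu> / 2 * (norm (xs - x))\<^sup>2 \<le> F xs"
    and convex: "F x + s \<bullet> (y - x) \<le> F y"
    and opt: "F xs + h xs \<le> F y' + h y'"
  defines "gap \<equiv> \<lambda>u. F u + h u - (F xs + h xs)"
    and "v \<equiv> \<beta> *\<^sub>R z + (1 - \<beta>) *\<^sub>R x"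
    and "z' \<equiv> \<beta> *\<^sub>R z + (1 - \<beta>) *\<^sub>R x + (\<gamma> / \<eta>) *\<^sub>R (y' - x)"
  shows "(norm (z' - xs))\<^sup>2 + 2 * \<gamma> * \<beta> / \<theta>1 * gap y'
    \<le> \<beta> * (norm (z - xs))\<^sup>2
      + 2 * \<gamma> * \<beta> / \<theta>1 * (\<theta>2 * gap w + (1 - \<theta>1 - \<theta>2) * gap y)
      + 2 * \<gamma> * \<beta> / \<theta>1 * (\<eta> * (norm (g - s))\<^sup>2 - \<theta>2 * (F w - F x - s \<bullet> (w - x)))
      + 2 * \<gamma> * ((g - s) \<bullet> (xs - v))"
proof -
  define d where "d = y' - x"
  define e where "e = g - s"
  define D where "D = F w - F x - s \<bullet> (w - x)"
  define a where "a = d /\<^sub>R \<eta> + e"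
  define \<theta>3 where "\<theta>3 = 1 - \<theta>1 - \<theta>2"
  define W where "W = 1 - \<beta> + \<beta> / \<theta>1"
  define E where "E = 2 * \<eta> / 3 * (norm e)\<^sup>2 - 1 / (2 * \<eta>) * (norm d)\<^sup>2"
  have \<theta>3: "0 \<le> \<theta>3" using par by (simp add: \<theta>3_def)
  have \<beta>: "1/2 \<le> \<beta>" "\<beta> \<le> 1" "1 - \<beta> = \<gamma> * \<mu>" using par by auto
  have gen: "F y' + h y' \<le> F x + h u + s \<bullet> (u - x) + a \<bullet> (u - x) + E"
    if "u \<in> {xs, w, y}" for u
    using prox_gradient_descent[of \<eta> h y' x g u F s, OF par(2) prox[OF that] descent]
    by (simp add: a_def d_def e_def E_def)
  have Bs: "gap y' \<le> - (\<mu> / 2 * (norm (xs - x))\<^sup>2) + a \<bullet> (xs - x) + E"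
    using gen[of xs] strong by (simp add: gap_def)
  have Bw: "gap y' \<le> gap w - D + a \<bullet> (w - x) + E"
    using gen[of w] by (simp add: gap_def D_def)
  have By: "gap y' \<le> gap y + a \<bullet> (y - x) + E"
    using gen[of y] convex by (simp add: gap_def)
  have W: "\<beta> / \<theta>1 \<le> W" "\<theta>1 * W \<le> 3/2 * \<beta>"
  proof -
    show "\<beta> / \<theta>1 \<le> W" using \<beta> by (simp add: W_def)
    have "\<theta>1 * (1 - \<beta>) \<le> 1/2 * (1/2)" using par \<beta> by (intro mult_mono) auto
    moreover have "\<theta>1 * W = \<theta>1 * (1 - \<beta>) + \<beta>" using par by (simp add: W_def field_simps)
    ultimately show "\<theta>1 * W \<le> 3/2 * \<beta>" using \<beta> by linarith
  qed
  have weights: "1 + \<beta> / \<theta>1 * \<theta>2 + \<beta> / \<theta>1 * \<theta>3 = W"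
    using par by (simp add: W_def \<theta>3_def field_simps)
  have "\<theta>1 *\<^sub>R (xs - z) = \<theta>1 *\<^sub>R (xs - x) + \<theta>2 *\<^sub>R (w - x) + \<theta>3 *\<^sub>R (y - x)"
    by (simp add: x \<theta>3_def algebra_simps)
  then have "(\<beta> / \<theta>1) *\<^sub>R (\<theta>1 *\<^sub>R (xs - z))
      = (\<beta> / \<theta>1) *\<^sub>R (\<theta>1 *\<^sub>R (xs - x) + \<theta>2 *\<^sub>R (w - x) + \<theta>3 *\<^sub>R (y - x))" by simp
  then have "\<beta> *\<^sub>R (xs - z)
      = \<beta> *\<^sub>R (xs - x) + (\<beta> / \<theta>1 * \<theta>2) *\<^sub>R (w - x) + (\<beta> / \<theta>1 * \<theta>3) *\<^sub>R (y - x)"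
    using par by (simp add: scaleR_add_right)
  then have "xs - v = (xs - x) + (\<beta> / \<theta>1 * \<theta>2) *\<^sub>R (w - x) + (\<beta> / \<theta>1 * \<theta>3) *\<^sub>R (y - x)"
    by (simp add: v_def algebra_simps)
  then have inner_v: "a \<bullet> (xs - v) = a \<bullet> (xs - x) + \<beta> / \<theta>1 * \<theta>2 * (a \<bullet> (w - x))
      + \<beta> / \<theta>1 * \<theta>3 * (a \<bullet> (y - x))"
    by (simp only: inner_add_right inner_scaleR_right)
  \<comment> \<open>The three instances are added with weights whose total is \<^term>\<open>W\<close>.\<close>
  have w2: "0 \<le> \<beta> / \<theta>1 * \<theta>2" "0 \<le> \<beta> / \<theta>1 * \<theta>3" using \<beta> par \<theta>3 by auto
  have "W * gap y' = gap y' + \<beta> / \<theta>1 * \<theta>2 * gap y' + \<beta> / \<theta>1 * \<theta>3 * gap y'"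
    unfolding weights[symmetric] by (simp add: algebra_simps)
  also have "\<dots> \<le> (- (\<mu> / 2 * (norm (xs - x))\<^sup>2) + a \<bullet> (xs - x) + E)
      + \<beta> / \<theta>1 * \<theta>2 * (gap w - D + a \<bullet> (w - x) + E)
      + \<beta> / \<theta>1 * \<theta>3 * (gap y + a \<bullet> (y - x) + E)"
    using Bs mult_left_mono[OF Bw w2(1)] mult_left_mono[OF By w2(2)] by linarith
  also have "\<dots> = - (\<mu> / 2 * (norm (xs - x))\<^sup>2) + \<beta> / \<theta>1 * (\<theta>2 * (gap w - D) + \<theta>3 * gap y)
      + a \<bullet> (xs - v) + W * E"
    unfolding inner_v weights[symmetric] by (simp add: algebra_simps add_divide_distrib)
  finally have comb: "W * gap y' \<le> - (\<mu> / 2 * (norm (xs - x))\<^sup>2)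
      + \<beta> / \<theta>1 * (\<theta>2 * (gap w - D) + \<theta>3 * gap y) + a \<bullet> (xs - v) + W * E" .
  \<comment> \<open>The new gap is nonnegative, so the surplus of \<^term>\<open>W\<close> over \<open>\<beta>/\<theta>1\<close>, the weight
    that the Lyapunov function gives it up to the factor \<open>2\<gamma>\<close>, can be discarded.\<close>
  have "\<beta> / \<theta>1 * gap y' \<le> W * gap y'"
    using W(1) opt by (intro mult_right_mono) (auto simp: gap_def)
  with comb have "2 * \<gamma> * (\<beta> / \<theta>1 * gap y') \<le> 2 * \<gamma> * (- (\<mu> / 2 * (norm (xs - x))\<^sup>2)
      + \<beta> / \<theta>1 * (\<theta>2 * (gap w - D) + \<theta>3 * gap y) + a \<bullet> (xs - v) + W * E)"
    using par by (intro mult_left_mono) auto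
  also have "\<dots> = - ((1 - \<beta>) * (norm (x - xs))\<^sup>2)
      + 2 * \<gamma> * \<beta> / \<theta>1 * (\<theta>2 * (gap w - D) + \<theta>3 * gap y) + 2 * \<gamma> * (a \<bullet> (xs - v))
      + 2 * \<gamma> * W * E"
    unfolding \<beta>(3) by (simp add: norm_minus_commute algebra_simps add_divide_distrib)
  finally have comb': "2 * \<gamma> * \<beta> / \<theta>1 * gap y' \<le> - ((1 - \<beta>) * (norm (x - xs))\<^sup>2)
      + 2 * \<gamma> * \<beta> / \<theta>1 * (\<theta>2 * (gap w - D) + \<theta>3 * gap y) + 2 * \<gamma> * (a \<bullet> (xs - v))
      + 2 * \<gamma> * W * E" by simp
  have "z' - xs = (v - xs) + (\<gamma> / \<eta>) *\<^sub>R d" by (simp add: z'_def v_def d_def)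
  then have "(norm (z' - xs))\<^sup>2 = (norm (v - xs))\<^sup>2 - 2 * \<gamma> * ((d /\<^sub>R \<eta>) \<bullet> (xs - v))
      + (\<gamma> / \<eta>)\<^sup>2 * (norm d)\<^sup>2"
    unfolding power2_norm_eq_inner
    by (simp add: inner_add_left inner_add_right inner_diff_left inner_diff_right
        inner_commute power2_eq_square divide_inverse algebra_simps)
  moreover have "(norm (v - xs))\<^sup>2 \<le> \<beta> * (norm (z - xs))\<^sup>2 + (1 - \<beta>) * (norm (x - xs))\<^sup>2"
  proof -
    have "v - xs = \<beta> *\<^sub>R (z - xs) + (1 - \<beta>) *\<^sub>R (x - xs)"
      by (simp add: v_def algebra_simps)
    then show ?thesis using norm_convex_combination_sq[of \<beta> "z - xs" "x - xs"] \<beta> by simp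
  qed
  ultimately have dist: "(norm (z' - xs))\<^sup>2 \<le> \<beta> * (norm (z - xs))\<^sup>2
      + (1 - \<beta>) * (norm (x - xs))\<^sup>2 - 2 * \<gamma> * ((d /\<^sub>R \<eta>) \<bullet> (xs - v)) + (\<gamma> / \<eta>)\<^sup>2 * (norm d)\<^sup>2"
    by linarith
  \<comment> \<open>The step length enters with a nonpositive total coefficient because
    \<open>\<gamma> / \<eta> \<le> W\<close>; the error coefficient uses \<open>W \<le> 3\<beta> / (2\<theta>1)\<close>.\<close>
  have "2 * \<gamma> * W * E + (\<gamma> / \<eta>)\<^sup>2 * (norm d)\<^sup>2 \<le> 2 * \<gamma> * \<beta> / \<theta>1 * (\<eta> * (norm e)\<^sup>2)"
  proof -
    have "\<gamma> / \<eta> \<le> 1 / (4 * \<theta>1)" using par by (simp add: field_simps)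
    also have "\<dots> \<le> \<beta> / \<theta>1" using par \<beta> by (simp add: field_simps)
    also have "\<dots> \<le> W" by (rule W)
    finally have "\<gamma> / \<eta> * (\<gamma> / \<eta>) \<le> \<gamma> / \<eta> * W" using par by (intro mult_left_mono) auto
    then have "(\<gamma> / \<eta>)\<^sup>2 * (norm d)\<^sup>2 \<le> \<gamma> / \<eta> * W * (norm d)\<^sup>2"
      by (intro mult_right_mono) (auto simp: power2_eq_square)
    moreover have "4 / 3 * \<gamma> * \<eta> * W * (norm e)\<^sup>2 \<le> 2 * \<gamma> * \<beta> / \<theta>1 * (\<eta> * (norm e)\<^sup>2)"
    proof -
      have "W \<le> 3 / 2 * \<beta> / \<theta>1" using W(2) par by (simp add: field_simps)
      then have "4 / 3 * \<gamma> * \<eta> * W * (norm e)\<^sup>2 \<le> 4 / 3 * \<gamma> * \<eta> * (3 / 2 * \<beta> / \<theta>1) * (norm e)\<^sup>2"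
        using par by (intro mult_right_mono mult_left_mono) auto
      then show ?thesis by (simp add: mult_ac)
    qed
    moreover have "2 * \<gamma> * W * E = 4 / 3 * \<gamma> * \<eta> * W * (norm e)\<^sup>2 - \<gamma> / \<eta> * W * (norm d)\<^sup>2"
      by (simp add: E_def algebra_simps)
    ultimately show ?thesis by linarith
  qed
  with comb' dist show ?thesis
    unfolding a_def e_def[symmetric] D_def[symmetric] \<theta>3_def[symmetric]
    by (simp add: inner_add_left algebra_simps add_divide_distrib)
qed

section \<open>The Markov chain of iterates\<close>

text \<open>
  Besides the equations for \<^term>\<open>\<beta>\<close> and \<^term>\<open>\<theta>2\<close>, which produce exact cancellations, the
  parameters are only constrained by the inequalities that the analysis of an iteration uses.
\<close>
locale l_katyusha =
  fixes n :: nat and f :: "nat \<Rightarrow> 'a::euclidean_space \<Rightarrow> real" and \<psi> :: "'a \<Rightarrow> ereal"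
    and S :: "nat set pmf" and \<rho> \<eta> \<theta>1 \<theta>2 \<gamma> \<beta> \<mu> LL :: real and x0 xs :: 'a
  assumes differentiable: "\<And>j x. j \<in> {1..n} \<Longrightarrow> f j differentiable (at x)"
    and smooth: "smooth (1 / (4 * \<eta>)) (average n f)"
    and strongly_convex: "strongly_convex \<mu> (average n f)"
    and proper: "\<And>x. \<psi> x \<noteq> -\<infinity>"
    and convex: "ereal_convex \<psi>"
    and prox_well_defined: "prox_well_defined \<eta> \<psi>"
    and minimizer: "is_arg_min (composite (average n f) \<psi>) (\<lambda>_. True) xs"
    and sampling: "set_pmf S \<subseteq> Pow {1..n}" "\<And>j. j \<in> {1..n} \<Longrightarrow> inclusion_prob S j > 0"
    and variance: "variance_bound n f \<psi> S \<rho> \<eta> \<theta>1 \<theta>2 \<gamma> \<beta> x0 LL"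
    and params: "0 < \<rho>" "\<rho> < 1" "0 < \<mu>" "0 < \<eta>" "0 < \<theta>1" "\<theta>1 \<le> 1/2" "0 < \<theta>2" "\<theta>2 \<le> 1/2"
      "0 < \<gamma>" "\<gamma> * \<mu> \<le> 1/2" "4 * \<theta>1 * \<gamma> \<le> \<eta>"
    and \<beta>_eq: "\<beta> = 1 - \<gamma> * \<mu>"
    and \<theta>2_eq: "\<theta>2 = 2 * \<eta> * LL"
begin

abbreviation F :: "'a \<Rightarrow> real" where "F \<equiv> average n f"

abbreviation chain :: "nat \<Rightarrow> ('a \<times> 'a \<times> 'a) pmf" where
  "chain \<equiv> katyusha n f \<psi> S \<rho> \<eta> \<theta>1 \<theta>2 \<gamma> \<beta> x0"

text \<open>
  The analysis is done with real numbers; \<^term>\<open>h\<close>, and hence \<open>gap\<close> and \<open>potential\<close> below, are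
  meaningful only at points of the domain of \<^term>\<open>\<psi>\<close>, where \<open>potential\<close> is the Lyapunov function.
\<close>
definition h :: "'a \<Rightarrow> real" where "h u = real_of_ereal (\<psi> u)"

definition gap :: "'a \<Rightarrow> real" where "gap u = F u + h u - (F xs + h xs)"

definition potential :: "'a \<times> 'a \<times> 'a \<Rightarrow> real" where
  "potential = (\<lambda>(y, z, w). (norm (z - xs))\<^sup>2 + 2 * \<gamma> * \<beta> / \<theta>1 * gap y
     + (2 * \<theta>2 + \<theta>1) * \<gamma> * \<beta> / (\<theta>1 * \<rho>) * gap w)"

definition next_y :: "'a \<times> 'a \<times> 'a \<Rightarrow> nat set \<Rightarrow> 'a" where
  "next_y = (\<lambda>(y, z, w) A. let x = katyusha_x \<theta>1 \<theta>2 (y, z, w) in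
     prox \<eta> \<psi> (x - \<eta> *\<^sub>R grad_estimator n f S x w A))"

definition next_z :: "'a \<times> 'a \<times> 'a \<Rightarrow> nat set \<Rightarrow> 'a" where
  "next_z = (\<lambda>(y, z, w) A. let x = katyusha_x \<theta>1 \<theta>2 (y, z, w) in
     \<beta> *\<^sub>R z + (1 - \<beta>) *\<^sub>R x + (\<gamma> / \<eta>) *\<^sub>R (next_y (y, z, w) A - x))"

definition step :: "'a \<times> 'a \<times> 'a \<Rightarrow> ('a \<times> 'a \<times> 'a) pmf" where
  "step = (\<lambda>(y, z, w). bind_pmf S (\<lambda>A. bind_pmf (bernoulli_pmf \<rho>) (\<lambda>b.
     return_pmf (next_y (y, z, w) A, next_z (y, z, w) A, if b then y else w))))"

definition rate :: real where
  "rate = min (\<gamma> * \<mu>) (min (\<theta>1 / 2) (\<rho> * \<theta>1 / (2 * \<theta>2 + \<theta>1)))"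

lemma chain_Suc: "chain (Suc k) = bind_pmf (chain k) step"
  by (auto simp: step_def next_y_def next_z_def Let_def intro!: bind_pmf_cong)

lemma \<beta>_pos: "0 < \<beta>"
  using params by (simp add: \<beta>_eq)

lemma finite_sampling: "finite (set_pmf S)"
  using finite_subset[OF sampling(1)] by simp

lemma \<psi>_eq_h: "\<psi> u \<noteq> \<infinity> \<Longrightarrow> \<psi> u = ereal (h u)"
  using proper[of u] by (auto simp: h_def ereal_real)

lemma composite_minimal: "composite F \<psi> xs \<le> composite F \<psi> u"
  using minimizer by (auto simp: is_arg_min_def not_less)

text \<open>
  Otherwise \<^term>\<open>\<psi>\<close> would be constantly infinite, every point would minimize the proximal
  objective, and the minimizer would not be unique.
\<close>
lemma minimizer_finite: "\<psi> xs \<noteq> \<infinity>"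
proof
  assume "\<psi> xs = \<infinity>"
  then have inf: "\<psi> u = \<infinity>" for u
    using composite_minimal[of u] by (cases "\<psi> u") (auto simp: composite_def)
  have "is_arg_min (prox_objective \<eta> \<psi> 0) (\<lambda>_. True) u" for u
    using params by (simp add: is_arg_min_def prox_objective_def inf)
  moreover obtain b :: 'a where "b \<in> Basis" using nonempty_Basis by blast
  ultimately show False
    using prox_well_defined nonzero_Basis[of b] unfolding prox_well_defined_def by metis
qed

lemma composite_diff:
  assumes "\<psi> u \<noteq> \<infinity>"
  shows "composite F \<psi> u - composite F \<psi> xs = ereal (gap u)"
  by (simp add: composite_def gap_def \<psi>_eq_h[OF assms] \<psi>_eq_h[OF minimizer_finite])

lemma gap_nonneg:
  assumes "\<psi> u \<noteq> \<infinity>"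
  shows "0 \<le> gap u"
  using composite_minimal[of u]
  by (simp add: composite_def gap_def \<psi>_eq_h[OF assms] \<psi>_eq_h[OF minimizer_finite])

lemma lyapunov_eq_potential:
  assumes "\<psi> y \<noteq> \<infinity>" "\<psi> w \<noteq> \<infinity>"
  shows "lyapunov (composite F \<psi>) xs \<rho> \<theta>1 \<theta>2 \<gamma> \<beta> (y, z, w) = ereal (potential (y, z, w))"
  by (simp add: lyapunov_def potential_def composite_diff assms)

lemma potential_nonneg:
  assumes "\<psi> y \<noteq> \<infinity>" "\<psi> w \<noteq> \<infinity>"
  shows "0 \<le> potential (y, z, w)"
  using gap_nonneg[OF assms(1)] gap_nonneg[OF assms(2)] params \<beta>_pos
  by (auto simp: potential_def intro!: add_nonneg_nonneg mult_nonneg_nonneg divide_nonneg_nonneg)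

lemma next_y_finite: "\<psi> (next_y s A) \<noteq> \<infinity>"
  unfolding next_y_def Let_def
  by (cases s) (use prox_arg_min(2)[OF prox_well_defined params(4) proper minimizer_finite] in simp)

lemma chain_finite:
  assumes "\<psi> x0 \<noteq> \<infinity>" "(y, z, w) \<in> set_pmf (chain k)"
  shows "\<psi> y \<noteq> \<infinity>" "\<psi> w \<noteq> \<infinity>"
proof -
  have "\<forall>y z w. (y, z, w) \<in> set_pmf (chain k) \<longrightarrow> \<psi> y \<noteq> \<infinity> \<and> \<psi> w \<noteq> \<infinity>"
  proof (induction k)
    case 0
    then show ?case using assms(1) by simp
  next
    case (Suc k)
    then show ?case
      unfolding chain_Suc step_def using next_y_finite by (fastforce split: if_splits)
  qed
  then show "\<psi> y \<noteq> \<infinity>" "\<psi> w \<noteq> \<infinity>" using assms(2) by blast+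
qed

lemma step_pathwise:
  fixes y z w :: 'a
  assumes fin: "\<psi> y \<noteq> \<infinity>" "\<psi> w \<noteq> \<infinity>"
  defines "x \<equiv> katyusha_x \<theta>1 \<theta>2 (y, z, w)"
  defines "e \<equiv> \<lambda>A. grad_estimator n f S x w A - gradient F x"
  shows "(norm (next_z (y, z, w) A - xs))\<^sup>2 + 2 * \<gamma> * \<beta> / \<theta>1 * gap (next_y (y, z, w) A)
    \<le> \<beta> * (norm (z - xs))\<^sup>2
      + 2 * \<gamma> * \<beta> / \<theta>1 * (\<theta>2 * gap w + (1 - \<theta>1 - \<theta>2) * gap y)
      + 2 * \<gamma> * \<beta> / \<theta>1 * (\<eta> * (norm (e A))\<^sup>2 - \<theta>2 * bregman F w x)
      + 2 * \<gamma> * (e A \<bullet> (xs - (\<beta> *\<^sub>R z + (1 - \<beta>) *\<^sub>R x)))"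
proof -
  define g where "g = grad_estimator n f S x w A"
  define y' where "y' = prox \<eta> \<psi> (x - \<eta> *\<^sub>R g)"
  have y': "next_y (y, z, w) A = y'"
    by (simp add: next_y_def y'_def x_def g_def Let_def)
  have z': "next_z (y, z, w) A = \<beta> *\<^sub>R z + (1 - \<beta>) *\<^sub>R x + (\<gamma> / \<eta>) *\<^sub>R (y' - x)"
    by (simp add: next_z_def x_def y' Let_def)
  have y'_fin: "\<psi> y' \<noteq> \<infinity>" using next_y_finite y' by metis
  have prox_ineq: "\<eta> * h y' + (x - \<eta> *\<^sub>R g - y') \<bullet> (u - y') \<le> \<eta> * h u"
    if "u \<in> {xs, w, y}" for u
  proof -
    have "\<psi> u \<noteq> \<infinity>" using that fin minimizer_finite by auto
    from prox_inequality[OF prox_well_defined params(4) proper convex this] show ?thesis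
      unfolding h_def y'_def .
  qed
  have strong: "F u + gradient F u \<bullet> (v - u) + \<mu> / 2 * (norm (v - u))\<^sup>2 \<le> F v" for u v
    using strongly_convex unfolding strongly_convex_def by blast
  have convex_F: "F x + gradient F x \<bullet> (y - x) \<le> F y"
  proof -
    have "0 \<le> \<mu> / 2 * (norm (y - x))\<^sup>2" using params by simp
    with strong[of x y] show ?thesis by linarith
  qed
  have "F y' \<le> F x + gradient F x \<bullet> (y' - x) + 1 / (4 * \<eta>) / 2 * (norm (y' - x))\<^sup>2"
    using smooth unfolding smooth_def by blast
  then have descent: "F y' \<le> F x + gradient F x \<bullet> (y' - x) + 1 / (8 * \<eta>) * (norm (y' - x))\<^sup>2"
    by simp
  have opt: "F xs + h xs \<le> F y' + h y'" using gap_nonneg[OF y'_fin] by (simp add: gap_def)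
  have x_eq: "x = \<theta>1 *\<^sub>R z + \<theta>2 *\<^sub>R w + (1 - \<theta>1 - \<theta>2) *\<^sub>R y"
    by (simp add: x_def katyusha_x_def)
  have "0 \<le> \<theta>2" "\<theta>1 + \<theta>2 \<le> 1" using params by auto
  from coupling_step[OF params(3,4,5,6) this params(9,10,11) \<beta>_eq x_eq prox_ineq descent
      strong convex_F opt]
  show ?thesis
    unfolding y' z' e_def g_def[symmetric] bregman_def gap_def by simp
qed

text \<open>
  Averaging over the sampled set kills the term that is linear in the error, by unbiasedness.  The
  choice \<^term>\<open>\<theta>2 = 2 * \<eta> * LL\<close> is made so that the Bregman term absorbs the variance exactly.
\<close>
lemma step_expectation:
  assumes s: "(y, z, w) \<in> set_pmf (chain k)" and fin: "\<psi> y \<noteq> \<infinity>" "\<psi> w \<noteq> \<infinity>"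
  shows "measure_pmf.expectation S
      (\<lambda>A. (norm (next_z (y, z, w) A - xs))\<^sup>2 + 2 * \<gamma> * \<beta> / \<theta>1 * gap (next_y (y, z, w) A))
    \<le> \<beta> * (norm (z - xs))\<^sup>2 + 2 * \<gamma> * \<beta> / \<theta>1 * (\<theta>2 * gap w + (1 - \<theta>1 - \<theta>2) * gap y)"
    (is "measure_pmf.expectation S ?lhs \<le> ?B")
proof -
  define x where "x = katyusha_x \<theta>1 \<theta>2 (y, z, w)"
  define e where "e A = grad_estimator n f S x w A - gradient F x" for A
  define a where "a = 2 * \<gamma> * \<beta> / \<theta>1"
  define v where "v = xs - (\<beta> *\<^sub>R z + (1 - \<beta>) *\<^sub>R x)"
  note int = integrable_measure_pmf_finite[OF finite_sampling]
  have a: "0 \<le> a" using params \<beta>_pos by (simp add: a_def)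
  have "measure_pmf.expectation S ?lhs \<le> measure_pmf.expectation S
      (\<lambda>A. ?B + a * (\<eta> * (norm (e A))\<^sup>2 - \<theta>2 * bregman F w x) + 2 * \<gamma> * (e A \<bullet> v))"
    using step_pathwise[OF fin, of z] unfolding x_def e_def v_def a_def
    by (intro integral_mono int) auto
  also have "\<dots> = ?B + a * (\<eta> * measure_pmf.expectation S (\<lambda>A. (norm (e A))\<^sup>2)
      - \<theta>2 * bregman F w x) + 2 * \<gamma> * measure_pmf.expectation S (\<lambda>A. e A \<bullet> v)"
    by (simp add: int)
  also have "measure_pmf.expectation S (\<lambda>A. e A \<bullet> v) = 0"
    unfolding e_def by (rule grad_estimator_unbiased[OF differentiable sampling])
  also have "a * (\<eta> * measure_pmf.expectation S (\<lambda>A. (norm (e A))\<^sup>2) - \<theta>2 * bregman F w x) \<le> 0"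
  proof -
    have "measure_pmf.expectation S (\<lambda>A. (norm (e A))\<^sup>2) \<le> 2 * LL * bregman F w x"
      using variance s unfolding variance_bound_def Let_def x_def e_def by fast
    then have "\<eta> * measure_pmf.expectation S (\<lambda>A. (norm (e A))\<^sup>2) \<le> \<eta> * (2 * LL * bregman F w x)"
      using params by (intro mult_left_mono) auto
    then have "\<eta> * measure_pmf.expectation S (\<lambda>A. (norm (e A))\<^sup>2) - \<theta>2 * bregman F w x \<le> 0"
      by (simp add: \<theta>2_eq mult_ac)
    with a show ?thesis by (rule mult_nonneg_nonpos)
  qed
  finally show ?thesis by simp
qed

text \<open>
  In units of \<open>2\<gamma>\<beta>/\<theta>1\<close>, the gap at \<^term>\<open>y\<close> has weight \<open>1\<close> and the proximal step reduces it by
  \<open>\<theta>1 + \<theta>2\<close>, while the gap at \<^term>\<open>w\<close> has weight \<open>c = (2\<theta>2 + \<theta>1)/(2\<rho>)\<close> and contributes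
  \<open>\<theta>2\<close> to the new point.  Refreshing \<^term>\<open>w\<close> with probability \<^term>\<open>\<rho>\<close> moves the amount
  \<open>c\<rho> = \<theta>2 + \<theta>1/2\<close> from the gap at \<^term>\<open>w\<close> to that at \<^term>\<open>y\<close>, and \<open>c\<close> is chosen such that
  both then decrease by \<open>\<theta>1/2\<close>.  The relative decreases of the three parts of the potential are
  the three members of the minimum defining \<^term>\<open>rate\<close>.
\<close>
lemma potential_drift:
  fixes Z p q :: real
  assumes "0 \<le> Z" "0 \<le> p" "0 \<le> q"
  shows "\<beta> * Z + 2 * \<gamma> * \<beta> / \<theta>1 * (\<theta>2 * q + (1 - \<theta>1 - \<theta>2) * p)
      + (2 * \<theta>2 + \<theta>1) * \<gamma> * \<beta> / (\<theta>1 * \<rho>) * (\<rho> * p + (1 - \<rho>) * q)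
    \<le> (1 - rate) * (Z + 2 * \<gamma> * \<beta> / \<theta>1 * p + (2 * \<theta>2 + \<theta>1) * \<gamma> * \<beta> / (\<theta>1 * \<rho>) * q)"
proof -
  define a where "a = 2 * \<gamma> * \<beta> / \<theta>1"
  define c where "c = (2 * \<theta>2 + \<theta>1) / (2 * \<rho>)"
  have a: "0 \<le> a" using params \<beta>_pos by (simp add: a_def)
  have c: "c * \<rho> = \<theta>2 + \<theta>1 / 2" "0 < c" using params by (auto simp: c_def field_simps)
  have ac: "(2 * \<theta>2 + \<theta>1) * \<gamma> * \<beta> / (\<theta>1 * \<rho>) = a * c" by (simp add: a_def c_def)
  have r: "rate \<le> \<gamma> * \<mu>" "rate \<le> \<theta>1 / 2" "rate * c \<le> \<theta>1 / 2"
  proof -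
    have "rate \<le> \<rho> * \<theta>1 / (2 * \<theta>2 + \<theta>1)" by (simp add: rate_def)
    also have "\<dots> = \<theta>1 / 2 / c" using params by (simp add: c_def field_simps)
    finally show "rate * c \<le> \<theta>1 / 2" using c by (simp add: pos_le_divide_eq)
    show "rate \<le> \<gamma> * \<mu>" "rate \<le> \<theta>1 / 2"
      unfolding rate_def by (meson min.cobounded1 min.cobounded2 order.trans)+
  qed
  have "\<theta>2 * q + (1 - \<theta>1 - \<theta>2) * p + c * (\<rho> * p + (1 - \<rho>) * q)
      = (1 - \<theta>1 - \<theta>2 + c * \<rho>) * p + (\<theta>2 + c - c * \<rho>) * q"
    by (simp add: algebra_simps)
  also have "\<dots> = (1 - \<theta>1 / 2) * p + (c - \<theta>1 / 2) * q"
    unfolding c(1) by (simp add: algebra_simps)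
  also have "\<dots> \<le> (1 - rate) * p + (c - rate * c) * q"
    using r assms by (intro add_mono mult_right_mono) auto
  finally have "a * (\<theta>2 * q + (1 - \<theta>1 - \<theta>2) * p + c * (\<rho> * p + (1 - \<rho>) * q))
      \<le> a * ((1 - rate) * p + (c - rate * c) * q)"
    using a by (rule mult_left_mono)
  moreover have "\<beta> * Z \<le> (1 - rate) * Z" using r assms by (intro mult_right_mono) (auto simp: \<beta>_eq)
  ultimately show ?thesis
    unfolding ac a_def[symmetric] by (simp add: algebra_simps)
qed

lemma step_potential:
  assumes s: "(y, z, w) \<in> set_pmf (chain k)" and fin: "\<psi> y \<noteq> \<infinity>" "\<psi> w \<noteq> \<infinity>"
  shows "(\<integral>\<^sup>+ t. ennreal (potential t) \<partial>step (y, z, w))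
    \<le> ennreal ((1 - rate) * potential (y, z, w))"
proof -
  define G where "G A = (norm (next_z (y, z, w) A - xs))\<^sup>2
      + 2 * \<gamma> * \<beta> / \<theta>1 * gap (next_y (y, z, w) A)" for A
  define C where "C = (2 * \<theta>2 + \<theta>1) * \<gamma> * \<beta> / (\<theta>1 * \<rho>)"
  note int = integrable_measure_pmf_finite[OF finite_sampling]
  have C: "0 \<le> C" using params \<beta>_pos by (simp add: C_def)
  have G: "0 \<le> G A" for A
    using gap_nonneg[OF next_y_finite] params \<beta>_pos by (simp add: G_def)
  have gaps: "0 \<le> gap y" "0 \<le> gap w" using gap_nonneg fin by auto
  have coin: "(\<integral>\<^sup>+ b. ennreal (potential (next_y (y, z, w) A, next_z (y, z, w) A, if b then y else w))
      \<partial>bernoulli_pmf \<rho>) = ennreal (G A + C * (\<rho> * gap y + (1 - \<rho>) * gap w))" for A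
  proof -
    have "ennreal (G A + C * gap y) * \<rho> + ennreal (G A + C * gap w) * (1 - \<rho>)
        = ennreal ((G A + C * gap y) * \<rho> + (G A + C * gap w) * (1 - \<rho>))"
      using params G[of A] C gaps by (simp add: ennreal_plus ennreal_mult)
    also have "(G A + C * gap y) * \<rho> + (G A + C * gap w) * (1 - \<rho>)
        = G A + C * (\<rho> * gap y + (1 - \<rho>) * gap w)" by (simp add: algebra_simps)
    finally show ?thesis using params by (simp add: potential_def G_def C_def)
  qed
  have "(\<integral>\<^sup>+ t. ennreal (potential t) \<partial>step (y, z, w))
      = (\<integral>\<^sup>+ A. ennreal (G A + C * (\<rho> * gap y + (1 - \<rho>) * gap w)) \<partial>S)"
    unfolding step_def by (simp add: nn_integral_bind_pmf coin)
  also have "\<dots> = ennreal (measure_pmf.expectation S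
      (\<lambda>A. G A + C * (\<rho> * gap y + (1 - \<rho>) * gap w)))"
    using G C gaps params by (intro nn_integral_eq_integral int AE_pmfI) auto
  also have "measure_pmf.expectation S (\<lambda>A. G A + C * (\<rho> * gap y + (1 - \<rho>) * gap w))
      = measure_pmf.expectation S G + C * (\<rho> * gap y + (1 - \<rho>) * gap w)"
    by (simp add: int)
  also have "ennreal \<dots> \<le> ennreal ((1 - rate) * potential (y, z, w))"
    using step_expectation[OF s fin] potential_drift[of "(norm (z - xs))\<^sup>2" "gap y" "gap w"] gaps
    by (intro ennreal_leI) (simp add: G_def[abs_def] C_def potential_def)
  finally show ?thesis .
qed

lemma rate_le_1: "rate \<le> 1"
  using params by (simp add: rate_def)

abbreviation expected :: "nat \<Rightarrow> ennreal" where
  "expected \<equiv> expected_lyapunov n f \<psi> S \<rho> \<eta> \<theta>1 \<theta>2 \<gamma> \<beta> x0 xs"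

lemma expected_eq_potential:
  assumes "\<psi> x0 \<noteq> \<infinity>"
  shows "expected k = (\<integral>\<^sup>+ s. ennreal (potential s) \<partial>chain k)"
  unfolding expected_lyapunov_def
proof (intro nn_integral_cong_AE AE_pmfI)
  fix s assume s: "s \<in> set_pmf (chain k)"
  obtain y z w where yzw: "s = (y, z, w)" by (cases s)
  show "e2ennreal (lyapunov (composite F \<psi>) xs \<rho> \<theta>1 \<theta>2 \<gamma> \<beta> s) = ennreal (potential s)"
    unfolding yzw lyapunov_eq_potential[OF chain_finite[OF assms s[unfolded yzw]]] by simp
qed

text \<open>
  Iteration of the one-step bound by the Markov property.  The variance bound is known only at
  states that the chain reaches, hence the restriction to its support.
\<close>
lemma expected_lyapunov_contracts:
  assumes "\<psi> x0 \<noteq> \<infinity>"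
  shows "expected k \<le> ennreal ((1 - rate) ^ k) * expected 0"
proof (induction k)
  case (Suc k)
  have "expected (Suc k) = (\<integral>\<^sup>+ s. (\<integral>\<^sup>+ t. ennreal (potential t) \<partial>step s) \<partial>chain k)"
    unfolding expected_eq_potential[OF assms] chain_Suc by (rule nn_integral_bind_pmf)
  also have "\<dots> \<le> (\<integral>\<^sup>+ s. ennreal (1 - rate) * ennreal (potential s) \<partial>chain k)"
  proof (intro nn_integral_mono_AE AE_pmfI)
    fix s assume s: "s \<in> set_pmf (chain k)"
    obtain y z w where yzw: "s = (y, z, w)" by (cases s)
    note fin = chain_finite[OF assms s[unfolded yzw]]
    show "(\<integral>\<^sup>+ t. ennreal (potential t) \<partial>step s) \<le> ennreal (1 - rate) * ennreal (potential s)"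
      using step_potential[OF s[unfolded yzw] fin] rate_le_1 potential_nonneg[OF fin]
      by (simp add: yzw ennreal_mult)
  qed
  also have "\<dots> = ennreal (1 - rate) * expected k"
    by (simp add: nn_integral_cmult expected_eq_potential[OF assms])
  also have "\<dots> \<le> ennreal (1 - rate) * (ennreal ((1 - rate) ^ k) * expected 0)"
    by (rule mult_left_mono[OF Suc]) simp
  also have "\<dots> = ennreal ((1 - rate) ^ Suc k) * expected 0"
    using rate_le_1 by (simp add: ennreal_mult mult.assoc)
  finally show ?case .
qed simp

lemma expected_infinite_start:
  assumes "\<psi> x0 = \<infinity>"
  shows "expected 0 = top"
proof -
  have "lyapunov (composite F \<psi>) xs \<rho> \<theta>1 \<theta>2 \<gamma> \<beta> (x0, x0, x0) = \<infinity>"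
    using params \<beta>_pos
    by (simp add: lyapunov_def composite_def assms \<psi>_eq_h[OF minimizer_finite])
  then show ?thesis by (simp add: expected_lyapunov_def)
qed

text \<open>
  If \<^term>\<open>\<psi> x0 = \<infinity>\<close>, the initial expectation is infinite and the bound is trivial.
  Otherwise it follows from \<open>(1 - rate)\<^sup>k \<le> exp (- rate k)\<close>.
\<close>
lemma expected_lyapunov_le:
  assumes \<epsilon>: "0 < \<epsilon>" and rate: "0 < rate" and k: "ln (1 / \<epsilon>) \<le> rate * real k"
  shows "expected k \<le> ennreal \<epsilon> * expected 0"
proof (cases "\<psi> x0 = \<infinity>")
  case True
  then show ?thesis using \<epsilon> by (simp add: expected_infinite_start ennreal_mult_top)
next
  case False
  have "(1 - rate) ^ k \<le> exp (- rate) ^ k"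
    using rate_le_1 exp_ge_add_one_self[of "- rate"] by (intro power_mono) auto
  also have "\<dots> = exp (- (rate * real k))" by (simp add: exp_of_nat_mult[symmetric] mult.commute)
  also have "\<dots> \<le> exp (- ln (1 / \<epsilon>))" using k by simp
  also have "\<dots> = \<epsilon>" using \<epsilon> by (simp add: ln_div)
  finally have "ennreal ((1 - rate) ^ k) * expected 0 \<le> ennreal \<epsilon> * expected 0"
    by (intro mult_right_mono ennreal_leI) auto
  with expected_lyapunov_contracts[OF False, of k] show ?thesis by (rule order.trans)
qed

end

section \<open>The iteration count\<close>

text \<open>
  With \<open>m = max (1/2) (\<theta>2/\<rho>)\<close> and \<open>R\<close> the sum of the two square roots, the parameter choices give
  \<open>m / (\<eta>\<mu>) = max (2 max LL L / \<mu>) (2 LL / (\<mu>\<rho>)) \<le> 2 R\<^sup>2\<close>.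
  Hence \<open>\<sigma> = sqrt (\<eta>\<mu>m)\<close> satisfies both \<open>\<sigma> \<le> (3/2) R \<eta>\<mu>\<close> and \<open>m \<le> (3/2) R \<sigma>\<close>, where
  \<open>3/2\<close> bounds the square root of two.  The first inequality controls \<open>1/(\<gamma>\<mu>)\<close>, the second
  controls \<open>2/\<theta>1\<close>, through \<open>1/2 \<le> m\<close>, and the time scale \<open>1/\<rho> + 2\<theta>2/(\<rho>\<theta>1)\<close> of the
  reference point, through \<open>\<theta>2/\<rho> \<le> m\<close>.  Where \<open>\<theta>1\<close> is capped at \<open>1/2\<close>, the last two
  quantities are at most \<open>4\<close> and \<open>3/\<rho>\<close>.
\<close>
lemma contraction_rate:
  fixes \<mu> L LL \<rho> \<eta> \<theta>1 \<theta>2 \<gamma> :: real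
  assumes pos: "0 < \<mu>" "0 \<le> L" "0 < LL" "0 < \<rho>" "\<rho> < 1"
    and \<eta>: "\<eta> = 1/4 * inverse (max LL L)"
    and \<theta>2: "\<theta>2 = LL / (2 * max L LL)"
    and \<theta>1: "\<theta>1 = min (1/2) (sqrt (\<eta> * \<mu> * max (1/2) (\<theta>2 / \<rho>)))"
    and \<gamma>: "\<gamma> = 1 / max (2 * \<mu>) (4 * \<theta>1 / \<eta>)"
  shows "1 \<le> 6 * (1 / \<rho> + sqrt (L / \<mu>) + sqrt (LL / (\<mu> * \<rho>)))
              * min (\<gamma> * \<mu>) (min (\<theta>1 / 2) (\<rho> * \<theta>1 / (2 * \<theta>2 + \<theta>1)))"
proof -
  define N where "N = max L LL"
  define R where "R = sqrt (L / \<mu>) + sqrt (LL / (\<mu> * \<rho>))"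
  define K where "K = 1 / \<rho> + R"
  define m where "m = max (1/2) (\<theta>2 / \<rho>)"
  define \<sigma> where "\<sigma> = sqrt (\<eta> * \<mu> * m)"
  have N: "N > 0" "\<eta> = 1 / (4 * N)" using pos \<eta> by (auto simp: N_def max.commute field_simps)
  have \<eta>0: "\<eta> > 0" using N by simp
  have m: "1/2 \<le> m" "\<theta>2 / \<rho> \<le> m" by (auto simp: m_def)
  have R0: "0 < R" using pos by (auto simp: R_def intro: add_nonneg_pos)
  have \<sigma>0: "0 < \<sigma>" and \<sigma>2: "\<sigma>\<^sup>2 = \<eta> * \<mu> * m" using \<eta>0 pos m by (auto simp: \<sigma>_def)
  have \<theta>1_eq: "\<theta>1 = min (1/2) \<sigma>" by (simp add: \<theta>1 \<sigma>_def m_def)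
  have \<theta>2_bounds: "0 < \<theta>2" "2 * \<theta>2 \<le> 1" using pos by (auto simp: \<theta>2 field_simps)
  have R_L: "L / \<mu> \<le> R\<^sup>2"
  proof -
    have "sqrt (L / \<mu>) \<le> R" using pos by (simp add: R_def)
    then show ?thesis using sqrt_le_D by blast
  qed
  have R_LL: "LL / (\<mu> * \<rho>) \<le> R\<^sup>2"
  proof -
    have "sqrt (LL / (\<mu> * \<rho>)) \<le> R" using pos by (simp add: R_def)
    then show ?thesis using sqrt_le_D by blast
  qed
  have R_LL': "LL / \<mu> \<le> R\<^sup>2"
  proof -
    have "\<mu> * \<rho> \<le> \<mu>" using pos by simp
    then have "LL / \<mu> \<le> LL / (\<mu> * \<rho>)" using pos by (intro divide_left_mono) auto
    with R_LL show ?thesis by linarith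
  qed
  have N_R: "N \<le> \<mu> * R\<^sup>2" using R_L R_LL' pos by (auto simp: N_def max_def field_simps)
  have m_bound: "m \<le> 2 * R\<^sup>2 * (\<eta> * \<mu>)"
  proof -
    have "1/2 \<le> 2 * R\<^sup>2 * (\<eta> * \<mu>)" using N_R N(1) by (simp add: N(2) field_simps)
    moreover have "\<theta>2 / \<rho> \<le> 2 * R\<^sup>2 * (\<eta> * \<mu>)"
    proof -
      have "LL \<le> R\<^sup>2 * (\<mu> * \<rho>)" using R_LL pos by (simp add: field_simps)
      then have "LL / (2 * N * \<rho>) \<le> R\<^sup>2 * (\<mu> * \<rho>) / (2 * N * \<rho>)"
        using N(1) pos by (intro divide_right_mono) auto
      also have "\<dots> = 2 * R\<^sup>2 * (\<eta> * \<mu>)" using N(1) pos by (simp add: N(2) field_simps)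
      finally show ?thesis by (simp add: \<theta>2 N_def)
    qed
    ultimately show ?thesis by (simp add: m_def)
  qed
  have \<eta>\<mu>: "0 < \<eta> * \<mu>" using \<eta>0 pos by simp
  have m_\<sigma>: "2 * m \<le> 3 * R * \<sigma>"
  proof (rule power2_le_imp_le)
    have "m * m \<le> m * (2 * R\<^sup>2 * (\<eta> * \<mu>))" using m_bound m by (intro mult_left_mono) auto
    then have "m\<^sup>2 \<le> 2 * (R\<^sup>2 * \<sigma>\<^sup>2)" unfolding \<sigma>2 by (simp add: power2_eq_square mult_ac)
    moreover have "0 \<le> R\<^sup>2 * \<sigma>\<^sup>2" by simp
    ultimately have "4 * m\<^sup>2 \<le> 9 * (R\<^sup>2 * \<sigma>\<^sup>2)" by linarith
    then show "(2 * m)\<^sup>2 \<le> (3 * R * \<sigma>)\<^sup>2" by (simp add: power_mult_distrib)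
  qed (use R0 \<sigma>0 in auto)
  have \<sigma>_bound: "2 * \<sigma> \<le> 3 * R * (\<eta> * \<mu>)"
  proof (rule power2_le_imp_le)
    have "\<sigma>\<^sup>2 \<le> (\<eta> * \<mu>) * (2 * R\<^sup>2 * (\<eta> * \<mu>))"
      unfolding \<sigma>2 using m_bound \<eta>\<mu> by (intro mult_left_mono) auto
    then have "\<sigma>\<^sup>2 \<le> 2 * (R\<^sup>2 * (\<eta> * \<mu>)\<^sup>2)" by (simp add: power2_eq_square algebra_simps)
    moreover have "0 \<le> R\<^sup>2 * (\<eta> * \<mu>)\<^sup>2" by simp
    ultimately have "4 * \<sigma>\<^sup>2 \<le> 9 * (R\<^sup>2 * (\<eta> * \<mu>)\<^sup>2)" by linarith
    then show "(2 * \<sigma>)\<^sup>2 \<le> (3 * R * (\<eta> * \<mu>))\<^sup>2" by (simp add: power_mult_distrib)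
  qed (use R0 \<eta>\<mu> in auto)
  have K: "1 \<le> K" "R \<le> K" "0 < K" "K * \<rho> = 1 + R * \<rho>"
  proof -
    have "1 \<le> 1 / \<rho>" using pos by simp
    then show "1 \<le> K" "R \<le> K" "0 < K" using R0 pos(4) unfolding K_def by linarith+
    show "K * \<rho> = 1 + R * \<rho>" using pos by (simp add: K_def field_simps)
  qed
  have \<theta>10: "0 < \<theta>1" "\<theta>1 \<le> \<sigma>" using \<sigma>0 by (auto simp: \<theta>1_eq)
  have 1: "1 \<le> 6 * K * (\<gamma> * \<mu>)"
  proof -
    have "4 * \<theta>1 \<le> 6 * R * (\<eta> * \<mu>)" using \<sigma>_bound \<theta>10 by linarith
    also have "\<dots> \<le> 6 * K * (\<eta> * \<mu>)" using K \<eta>\<mu> by (intro mult_right_mono) auto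
    finally have "4 * \<theta>1 / \<eta> \<le> 6 * K * \<mu>" using \<eta>0 by (simp add: field_simps)
    moreover have "2 * \<mu> \<le> 6 * K * \<mu>" using K pos by simp
    ultimately have "max (2 * \<mu>) (4 * \<theta>1 / \<eta>) \<le> 6 * K * \<mu>" by simp
    moreover have "0 < max (2 * \<mu>) (4 * \<theta>1 / \<eta>)" using pos by (simp add: less_max_iff_disj)
    ultimately show ?thesis by (simp add: \<gamma> field_simps)
  qed
  have 2: "1 \<le> 6 * K * (\<theta>1 / 2)"
  proof (cases "\<sigma> \<le> 1/2")
    case True
    have "3 * R * \<sigma> \<le> 3 * K * \<sigma>" using K \<sigma>0 by simp
    with True m m_\<sigma> show ?thesis by (simp add: \<theta>1_eq)
  qed (use K in \<open>simp add: \<theta>1_eq\<close>)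
  have 3: "1 \<le> 6 * K * (\<rho> * \<theta>1 / (2 * \<theta>2 + \<theta>1))"
  proof -
    have "2 * \<theta>2 + \<theta>1 \<le> 6 * \<theta>1 + 6 * R * \<rho> * \<theta>1"
    proof (cases "\<sigma> \<le> 1/2")
      case True
      have "\<theta>2 \<le> m * \<rho>" using m pos by (simp add: field_simps)
      moreover have "2 * m * \<rho> \<le> 3 * R * \<sigma> * \<rho>" using m_\<sigma> pos by (intro mult_right_mono) auto
      ultimately show ?thesis using True \<sigma>0 \<theta>2_bounds by (simp add: \<theta>1_eq algebra_simps)
    next
      case False
      have "0 \<le> R * \<rho>" using R0 pos by simp
      with False \<theta>2_bounds show ?thesis by (simp add: \<theta>1_eq)
    qed
    also have "\<dots> = 6 * (K * \<rho>) * \<theta>1" unfolding K(4) by (simp add: algebra_simps)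
    finally show ?thesis using \<theta>10 \<theta>2_bounds by (simp add: field_simps)
  qed
  have "6 * (1 / \<rho> + sqrt (L / \<mu>) + sqrt (LL / (\<mu> * \<rho>))) = 6 * K"
    by (simp add: K_def R_def)
  with 1 2 3 show ?thesis unfolding min_def by presburger
qed

lemma smooth_mono:
  assumes "smooth L f" "L \<le> L'"
  shows "smooth L' f"
proof -
  have "L / 2 * (norm (x - y))\<^sup>2 \<le> L' / 2 * (norm (x - y))\<^sup>2" for x y :: 'a
    using assms(2) by (intro mult_right_mono) auto
  then show ?thesis
    using assms(1) unfolding smooth_def by (meson add_left_mono order.trans)
qed

text \<open>Compare both bounds at two distinct points.  This guarantees that \<^term>\<open>L\<close> is nonnegative.\<close>
lemma strongly_convex_le_smooth:
  fixes f :: "'a::euclidean_space \<Rightarrow> real"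
  assumes "smooth L f" "strongly_convex \<mu> f"
  shows "\<mu> \<le> L"
proof -
  obtain b :: 'a where b: "b \<in> Basis" using nonempty_Basis by blast
  have "f b \<le> f 0 + gradient f 0 \<bullet> (b - 0) + L / 2 * (norm (b - 0))\<^sup>2"
    using assms(1) unfolding smooth_def by blast
  moreover have "f 0 + gradient f 0 \<bullet> (b - 0) + \<mu> / 2 * (norm (b - 0))\<^sup>2 \<le> f b"
    using assms(2) unfolding strongly_convex_def by blast
  ultimately show ?thesis using b by simp
qed

theorem corollary5p3:
  "\<exists>c::real. 0 < c \<and> c \<le> 10 \<and>
    (\<forall>(n::nat) (f :: nat \<Rightarrow> real^'m::finite \<Rightarrow> real) (M :: nat \<Rightarrow> real^'m^'m)
      (L::real) (\<mu>::real) (\<psi> :: real^'m \<Rightarrow> ereal) (S :: nat set pmf) (\<rho>::real) (LL::real)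
      (\<eta>::real) (\<theta>1::real) (\<theta>2::real) (\<gamma>::real) (\<beta>::real) (x0 :: real^'m) (xs :: real^'m).
      n \<ge> 1 \<longrightarrow>
      (\<forall>j\<in>{1..n}. convex_on UNIV (f j)) \<longrightarrow>
      (\<forall>j\<in>{1..n}. matrix_smooth (M j) (f j)) \<longrightarrow>
      smooth L (average n f) \<longrightarrow>
      \<mu> > 0 \<longrightarrow>
      strongly_convex \<mu> (average n f) \<longrightarrow>
      (\<forall>x. \<psi> x \<noteq> -\<infinity>) \<longrightarrow>
      ereal_convex \<psi> \<longrightarrow>
      prox_well_defined \<eta> \<psi> \<longrightarrow>
      is_arg_min (composite (average n f) \<psi>) (\<lambda>_. True) xs \<longrightarrow>
      0 < \<rho> \<longrightarrow> \<rho> < 1 \<longrightarrow>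
      set_pmf S \<subseteq> Pow {1..n} \<longrightarrow>
      (\<forall>j\<in>{1..n}. inclusion_prob S j > 0) \<longrightarrow>
      LL > 0 \<longrightarrow>
      \<eta> = 1/4 * inverse (max LL L) \<longrightarrow>
      \<theta>2 = LL / (2 * max L LL) \<longrightarrow>
      \<theta>1 = min (1/2) (sqrt (\<eta> * \<mu> * max (1/2) (\<theta>2 / \<rho>))) \<longrightarrow>
      \<gamma> = 1 / max (2 * \<mu>) (4 * \<theta>1 / \<eta>) \<longrightarrow>
      \<beta> = 1 - \<gamma> * \<mu> \<longrightarrow>
      variance_bound n f \<psi> S \<rho> \<eta> \<theta>1 \<theta>2 \<gamma> \<beta> x0 LL \<longrightarrow>
      (\<forall>\<epsilon>::real. 0 < \<epsilon> \<longrightarrow> \<epsilon> < 1 \<longrightarrow>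
        (\<forall>k::nat. real k \<ge> c * (1 / \<rho> + sqrt (L / \<mu>) + sqrt (LL / (\<mu> * \<rho>))) * ln (1 / \<epsilon>) \<longrightarrow>
          expected_lyapunov n f \<psi> S \<rho> \<eta> \<theta>1 \<theta>2 \<gamma> \<beta> x0 xs k
            \<le> ennreal \<epsilon> * expected_lyapunov n f \<psi> S \<rho> \<eta> \<theta>1 \<theta>2 \<gamma> \<beta> x0 xs 0)))"
proof (intro exI[of _ 6] conjI allI impI)
  fix n :: nat and f :: "nat \<Rightarrow> real^'m \<Rightarrow> real" and M :: "nat \<Rightarrow> real^'m^'m"
    and L \<mu> \<rho> LL \<eta> \<theta>1 \<theta>2 \<gamma> \<beta> \<epsilon> :: real and \<psi> :: "real^'m \<Rightarrow> ereal" and S :: "nat set pmf"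
    and x0 xs :: "real^'m" and k :: nat
  assume M: "\<forall>j\<in>{1..n}. matrix_smooth (M j) (f j)"
    and smooth: "smooth L (average n f)" and \<mu>: "0 < \<mu>"
    and strong: "strongly_convex \<mu> (average n f)"
    and \<psi>: "\<forall>x. \<psi> x \<noteq> -\<infinity>" "ereal_convex \<psi>" "prox_well_defined \<eta> \<psi>"
    and xs: "is_arg_min (composite (average n f) \<psi>) (\<lambda>_. True) xs"
    and \<rho>: "0 < \<rho>" "\<rho> < 1"
    and S: "set_pmf S \<subseteq> Pow {1..n}" "\<forall>j\<in>{1..n}. inclusion_prob S j > 0"
    and LL: "0 < LL"
    and \<eta>: "\<eta> = 1/4 * inverse (max LL L)"
    and \<theta>2: "\<theta>2 = LL / (2 * max L LL)"
    and \<theta>1: "\<theta>1 = min (1/2) (sqrt (\<eta> * \<mu> * max (1/2) (\<theta>2 / \<rho>)))"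
    and \<gamma>: "\<gamma> = 1 / max (2 * \<mu>) (4 * \<theta>1 / \<eta>)"
    and \<beta>: "\<beta> = 1 - \<gamma> * \<mu>"
    and variance: "variance_bound n f \<psi> S \<rho> \<eta> \<theta>1 \<theta>2 \<gamma> \<beta> x0 LL"
    and \<epsilon>: "0 < \<epsilon>" "\<epsilon> < 1"
    and k: "6 * (1 / \<rho> + sqrt (L / \<mu>) + sqrt (LL / (\<mu> * \<rho>))) * ln (1 / \<epsilon>) \<le> real k"
  have L: "0 \<le> L" using strongly_convex_le_smooth[OF smooth strong] \<mu> by simp
  have max_pos: "0 < max LL L" using LL by simp
  then have \<eta>_pos: "0 < \<eta>" and \<eta>_inv: "1 / (4 * \<eta>) = max LL L"
    by (simp_all add: \<eta> inverse_eq_divide)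
  have \<theta>1_pos: "0 < \<theta>1" using \<eta>_pos \<mu> by (simp add: \<theta>1 less_max_iff_disj)
  have max_pos': "0 < max (2 * \<mu>) (4 * \<theta>1 / \<eta>)" using \<mu> by (simp add: less_max_iff_disj)
  have diff: "f j differentiable (at x)" if "j \<in> {1..n}" for j x
    using M that by (auto simp: matrix_smooth_def)
  interpret l_katyusha n f \<psi> S \<rho> \<eta> \<theta>1 \<theta>2 \<gamma> \<beta> \<mu> LL x0 xs
  proof
    show "smooth (1 / (4 * \<eta>)) (average n f)"
      using smooth by (rule smooth_mono) (simp add: \<eta>_inv)
    show "0 < \<gamma>" using max_pos' by (simp add: \<gamma>)
    show "\<gamma> * \<mu> \<le> 1/2" using max_pos' by (simp add: \<gamma> field_simps)
    have "4 * \<theta>1 / \<eta> \<le> max (2 * \<mu>) (4 * \<theta>1 / \<eta>)" by simp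
    then have "4 * \<theta>1 \<le> max (2 * \<mu>) (4 * \<theta>1 / \<eta>) * \<eta>"
      using \<eta>_pos by (simp only: pos_divide_le_eq)
    then have "4 * \<theta>1 / max (2 * \<mu>) (4 * \<theta>1 / \<eta>) \<le> \<eta>"
      using max_pos' by (simp only: pos_divide_le_eq mult.commute)
    then show "4 * \<theta>1 * \<gamma> \<le> \<eta>" by (simp add: \<gamma>)
    show "\<theta>2 = 2 * \<eta> * LL" by (simp add: \<theta>2 \<eta> max.commute field_simps)
    show "0 < \<theta>2" "\<theta>2 \<le> 1/2" using LL max_pos by (auto simp: \<theta>2 max.commute field_simps)
    show "\<theta>1 \<le> 1/2" by (simp add: \<theta>1)
  qed (use diff strong \<psi> xs S variance \<rho> \<mu> \<eta>_pos \<theta>1_pos \<beta> in auto)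
  define K where "K = 1 / \<rho> + sqrt (L / \<mu>) + sqrt (LL / (\<mu> * \<rho>))"
  have K: "1 \<le> 6 * K * rate"
    unfolding K_def rate_def by (rule contraction_rate[OF \<mu> L LL \<rho> \<eta> \<theta>2 \<theta>1 \<gamma>])
  have "0 < K" using \<rho> L LL \<mu> by (simp add: K_def add_pos_nonneg)
  with K have rate: "0 < rate" by (smt (verit) mult_nonneg_nonpos)
  have "ln (1 / \<epsilon>) \<le> (6 * K * rate) * ln (1 / \<epsilon>)"
    using mult_right_mono[OF K, of "ln (1 / \<epsilon>)"] \<epsilon> by simp
  also have "\<dots> = rate * (6 * K * ln (1 / \<epsilon>))" by simp
  also have "\<dots> \<le> rate * real k" using k rate by (intro mult_left_mono) (auto simp: K_def)
  finally show "expected_lyapunov n f \<psi> S \<rho> \<eta> \<theta>1 \<theta>2 \<gamma> \<beta> x0 xs k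
      \<le> ennreal \<epsilon> * expected_lyapunov n f \<psi> S \<rho> \<eta> \<theta>1 \<theta>2 \<gamma> \<beta> x0 xs 0"
    by (rule expected_lyapunov_le[OF \<epsilon>(1) rate])
qed simp_all

end
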